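(* Let $k \ge 2$ be an integer, and let $G=(V,E)$ be a finite simple graph with each edge colored blue or red, with $|V|=4(k-1)$, such that every vertex in $V$ belongs to a monochromatic $k$-clique of each color, and such that $G$ is edge-critical with respect to this property (removing any edge destroys the property). Then $G$ is isomorphic (as a $2$-colored graph) to some $G(X,Y,B,R)$, where $B(X,Y)$ and $R(X,Y)$ are complementary $(k-1)$-regular bipartite graphs on the bipartition $(X,Y)$.
   Context: For an integer $k\ge 2$, let $X$ and $Y$ be disjoint sets of $2(k-1)$ vertices each, and let $B(X,Y)$ and $R(X,Y)$ be two complementary $(k-1)$-regular bipartite graphs on the bipartition $(X,Y)$ (i.e., they partition the edge set of the complete bipartite graph on $(X,Y)$ and each is $(k-1)$-regular). The $2$-colored graph $G(X,Y,B,R)$ has vertex set $X \cup Y$; it contains all edges of the complete bipartite graph on $(X,Y)$, with edges of $B(X,Y)$ colored blue and edges of $R(X,Y)$ colored red; in addition, any two vertices of $X$ having a common neighbor in $B(X,Y)$ are joined by a blue edge, and any two vertices of $Y$ having a common neighbor in $R(X,Y)$ are joined by a red edge; there are no other edges. A monochromatic $k$-clique of a color is a set of $k$ pairwise adjacent vertices all of whose connecting edges have that color. *)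

theory Defs
  imports Main
begin

datatype color = Blue | Red

record 'a cgraph =
  verts :: "'a set"
  edges :: "'a set set"
  col :: "'a set \<Rightarrow> color"

text \<open>The values of \<open>col\<close> outside of \<open>edges\<close> are irrelevant: all notions below
  consult \<open>col\<close> on edges only.\<close>

definition finite_simple_cgraph :: "'a cgraph \<Rightarrow> bool" where
  "finite_simple_cgraph G \<longleftrightarrow>
     finite (verts G) \<and> (\<forall>e\<in>edges G. e \<subseteq> verts G \<and> card e = 2)"

definition mono_clique :: "'a cgraph \<Rightarrow> color \<Rightarrow> nat \<Rightarrow> 'a set \<Rightarrow> bool" where
  "mono_clique G c k K \<longleftrightarrow>
     K \<subseteq> verts G \<and> finite K \<and> card K = k \<and>
     (\<forall>u\<in>K. \<forall>v\<in>K. u \<noteq> v \<longrightarrow> {u, v} \<in> edges G \<and> col G {u, v} = c)"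

definition clique_covered :: "nat \<Rightarrow> 'a cgraph \<Rightarrow> bool" where
  "clique_covered k G \<longleftrightarrow> (\<forall>v\<in>verts G. \<forall>c. \<exists>K. mono_clique G c k K \<and> v \<in> K)"

definition remove_edge :: "'a cgraph \<Rightarrow> 'a set \<Rightarrow> 'a cgraph" where
  "remove_edge G e = G\<lparr>edges := edges G - {e}\<rparr>"

definition edge_critical :: "('a cgraph \<Rightarrow> bool) \<Rightarrow> 'a cgraph \<Rightarrow> bool" where
  "edge_critical P G \<longleftrightarrow> P G \<and> (\<forall>e\<in>edges G. \<not> P (remove_edge G e))"

definition cgraph_isomorphic :: "'a cgraph \<Rightarrow> 'b cgraph \<Rightarrow> bool" where
  "cgraph_isomorphic G H \<longleftrightarrow>
     (\<exists>f. bij_betw f (verts G) (verts H) \<and>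
        (\<forall>u\<in>verts G. \<forall>v\<in>verts G.
           ({u, v} \<in> edges G \<longleftrightarrow> {f u, f v} \<in> edges H) \<and>
           ({u, v} \<in> edges G \<longrightarrow> col G {u, v} = col H {f u, f v})))"

definition complete_bipartite :: "'a set \<Rightarrow> 'a set \<Rightarrow> 'a set set" where
  "complete_bipartite X Y = {{x, y} | x y. x \<in> X \<and> y \<in> Y}"

definition regular_bipartite :: "nat \<Rightarrow> 'a set \<Rightarrow> 'a set \<Rightarrow> 'a set set \<Rightarrow> bool" where
  "regular_bipartite d X Y B \<longleftrightarrow>
     B \<subseteq> complete_bipartite X Y \<and> (\<forall>v\<in>X \<union> Y. card {w. {v, w} \<in> B} = d)"

definition complementary_bipartite ::
    "'a set \<Rightarrow> 'a set \<Rightarrow> 'a set set \<Rightarrow> 'a set set \<Rightarrow> bool" where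
  "complementary_bipartite X Y B R \<longleftrightarrow>
     B \<union> R = complete_bipartite X Y \<and> B \<inter> R = {}"

definition common_neighbor_pairs :: "'a set \<Rightarrow> 'a set set \<Rightarrow> 'a set set" where
  "common_neighbor_pairs S B =
     {{u, v} | u v. u \<in> S \<and> v \<in> S \<and> u \<noteq> v \<and> (\<exists>w. {u, w} \<in> B \<and> {v, w} \<in> B)}"

text \<open>For disjoint \<open>X\<close>, \<open>Y\<close> and complementary \<open>B\<close>, \<open>R\<close>, the edges not
  coloured blue here are exactly those in \<open>R\<close> or in \<open>common_neighbor_pairs Y R\<close>.\<close>

definition GXYBR :: "'a set \<Rightarrow> 'a set \<Rightarrow> 'a set set \<Rightarrow> 'a set set \<Rightarrow> 'a cgraph" where
  "GXYBR X Y B R =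
     \<lparr>verts = X \<union> Y,
      edges = complete_bipartite X Y \<union> common_neighbor_pairs X B \<union> common_neighbor_pairs Y R,
      col = (\<lambda>e. if e \<in> B \<union> common_neighbor_pairs X B then Blue else Red)\<rparr>"

lemma GXYBR_red:
  assumes "X \<inter> Y = {}" "complementary_bipartite X Y B R"
    and "e \<in> edges (GXYBR X Y B R)"
  shows "col (GXYBR X Y B R) e = Red \<longleftrightarrow> e \<in> R \<union> common_neighbor_pairs Y R"
proof -
  have BR: "B \<union> R = complete_bipartite X Y" "B \<inter> R = {}"
    using assms(2) by (auto simp: complementary_bipartite_def)
  have "complete_bipartite X Y \<inter> common_neighbor_pairs X B = {}"
    "complete_bipartite X Y \<inter> common_neighbor_pairs Y R = {}"
    "common_neighbor_pairs X B \<inter> common_neighbor_pairs Y R = {}"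
    using assms(1) by (auto simp: complete_bipartite_def common_neighbor_pairs_def doubleton_eq_iff)
  with BR assms(3) show ?thesis
    unfolding GXYBR_def by auto
qed

lemma GXYBR_finite_simple:
  assumes "finite X" "finite Y" "X \<inter> Y = {}"
  shows "finite_simple_cgraph (GXYBR X Y B R)"
  using assms
  by (auto simp: finite_simple_cgraph_def GXYBR_def complete_bipartite_def
      common_neighbor_pairs_def card_insert_if)

end

theory Submission
  imports Defs
begin

text \<open>
  Write \<open>n = 4 (k - 1)\<close> and pick for every vertex a blue and a red \<open>k\<close>-clique through it. Take
  \<open>s\<close> of these blue and \<open>t\<close> of these red cliques, and let \<open>b\<close> and \<open>r\<close> count the chosen blue and
  red cliques through a given vertex. As long as no vertex has \<open>b = 0, r \<ge> 2\<close> or \<open>r = 0, b \<ge> 2\<close>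
  (the selection is balanced), \<open>b + r - 1 \<le> b r\<close> at every vertex. Summing, and using that a blue
  and a red clique share at most one vertex, gives \<open>k (s + t) - n \<le> s t\<close>.

  A blue clique can be dropped from a balanced selection unless it contains a vertex with
  \<open>b = 1, r \<ge> 2\<close>, and symmetrically for red. These obstructing vertices are distinct for
  distinct cliques, so one can drop cliques until \<open>s + t = n\<close>. Then the inequality is tight:
  \<open>s = t = n / 2\<close> and every chosen blue clique meets every chosen red one. If \<open>k \<ge> 3\<close>, no further clique can be
  dropped, so the obstructing vertices exhaust the graph: those of the red cliques form \<open>X\<close>,
  those of the blue cliques form \<open>Y\<close>. The chosen cliques span a copy of some \<open>G(X,Y,B,R)\<close>, and
  criticality leaves no other edge. For \<open>k = 2\<close> the graph contains an alternating 4-cycle.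
\<close>

section \<open>Selections of blue and red cliques, and the counting bound\<close>

text \<open>The cliques form indexed families, so a clique picked for several vertices counts with
  multiplicity.\<close>

definition deg :: "('i \<Rightarrow> 'a set) \<Rightarrow> 'i set \<Rightarrow> 'a \<Rightarrow> nat" where
  "deg A I v = card {i \<in> I. v \<in> A i}"

text \<open>Over the integers this says \<open>(b - 1) (r - 1) \<ge> 0\<close> for the two degrees
  at each vertex; a vertex in no selected clique is allowed.\<close>

definition balanced :: "'a set \<Rightarrow> ('i \<Rightarrow> 'a set) \<Rightarrow> ('j \<Rightarrow> 'a set) \<Rightarrow> 'i set \<Rightarrow> 'j set \<Rightarrow> bool" where
  "balanced V A C I J \<longleftrightarrow>
     (\<forall>v\<in>V. (deg A I v = 0 \<longrightarrow> deg C J v \<le> 1) \<and> (deg C J v = 0 \<longrightarrow> deg A I v \<le> 1))"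

lemma balanced_commute: "balanced V A C I J \<longleftrightarrow> balanced V C A J I"
  by (auto simp: balanced_def)

lemma deg_eq_sum:
  assumes "finite I"
  shows "deg A I v = (\<Sum>i\<in>I. of_bool (v \<in> A i))"
  using assms by (simp add: deg_def sum.If_cases of_bool_def Int_def)

lemma sum_deg:
  assumes "finite V" "finite I" "\<And>i. i \<in> I \<Longrightarrow> A i \<subseteq> V \<and> card (A i) = k"
  shows "(\<Sum>v\<in>V. deg A I v) = k * card I"
proof -
  have "(\<Sum>v\<in>V. deg A I v) = (\<Sum>i\<in>I. \<Sum>v\<in>V. of_bool (v \<in> A i))"
    unfolding deg_eq_sum[OF assms(2)] by (rule sum.swap)
  also have "\<dots> = (\<Sum>i\<in>I. k)"
  proof (rule sum.cong)
    fix i assume "i \<in> I"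
    then have "V \<inter> {v. v \<in> A i} = A i" "card (A i) = k" using assms(3) by auto
    then show "(\<Sum>v\<in>V. of_bool (v \<in> A i)) = k"
      using assms(1) by (simp add: of_bool_def sum.If_cases)
  qed simp
  finally show ?thesis by simp
qed

text \<open>Both sides count the triples \<open>(v, i, j)\<close> with \<open>v\<close> in
  \<open>A i \<inter> C j\<close>.\<close>

lemma sum_deg_mult_deg:
  assumes "finite V" "finite I" "finite J" "\<And>i. i \<in> I \<Longrightarrow> A i \<subseteq> V"
  shows "(\<Sum>v\<in>V. deg A I v * deg C J v) = (\<Sum>(i,j)\<in>I \<times> J. card (A i \<inter> C j))"
proof -
  have "(\<Sum>v\<in>V. deg A I v * deg C J v)
      = (\<Sum>v\<in>V. \<Sum>(i,j)\<in>I \<times> J. of_bool (v \<in> A i \<inter> C j))"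
    unfolding deg_eq_sum[OF assms(2)] deg_eq_sum[OF assms(3)] sum_product sum.cartesian_product
    by (simp only: Int_iff of_bool_conj)
  also have "\<dots> = (\<Sum>(i,j)\<in>I \<times> J. \<Sum>v\<in>V. of_bool (v \<in> A i \<inter> C j))"
    by (subst sum.swap) (simp add: case_prod_unfold)
  also have "\<dots> = (\<Sum>(i,j)\<in>I \<times> J. card (A i \<inter> C j))"
  proof (rule sum.cong, simp, clarify)
    fix i j assume "i \<in> I"
    then have "V \<inter> {v. v \<in> A i \<inter> C j} = A i \<inter> C j" using assms(4) by auto
    then show "(\<Sum>v\<in>V. of_bool (v \<in> A i \<inter> C j)) = card (A i \<inter> C j)"
      using assms(1) by (simp add: of_bool_def sum.If_cases)
  qed
  finally show ?thesis .
qed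

text \<open>The inequality \<open>b + r \<le> b r + 1\<close> is summed over \<open>V\<close>. The
  intersection sizes stay explicit because the equality case reads off from them that all pairs
  meet.\<close>

lemma balanced_bound:
  assumes "finite V" "finite I" "finite J" "balanced V A C I J"
    and "\<And>i. i \<in> I \<Longrightarrow> A i \<subseteq> V \<and> card (A i) = k"
    and "\<And>j. j \<in> J \<Longrightarrow> C j \<subseteq> V \<and> card (C j) = k"
  shows "k * (card I + card J) \<le> card V + (\<Sum>(i,j)\<in>I \<times> J. card (A i \<inter> C j))"
proof -
  have le: "b + r \<le> Suc (b * r)" if "b = 0 \<longrightarrow> r \<le> 1" "r = 0 \<longrightarrow> b \<le> 1" for b r :: nat
    using that by (cases b; cases r) auto
  have "k * (card I + card J) = (\<Sum>v\<in>V. deg A I v + deg C J v)"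
    using sum_deg[of V I A k] sum_deg[of V J C k] assms by (simp add: sum.distrib distrib_left)
  also have "\<dots> \<le> (\<Sum>v\<in>V. Suc (deg A I v * deg C J v))"
    using assms(4) by (intro sum_mono le) (auto simp: balanced_def)
  also have "\<dots> = card V + (\<Sum>v\<in>V. deg A I v * deg C J v)"
    by (simp add: sum_Suc)
  also have "(\<Sum>v\<in>V. deg A I v * deg C J v) = (\<Sum>(i,j)\<in>I \<times> J. card (A i \<inter> C j))"
    using assms by (intro sum_deg_mult_deg) auto
  finally show ?thesis .
qed

section \<open>Dropping cliques, and the vertices that prevent it\<close>

lemma deg_remove:
  assumes "finite I" "i \<in> I"
  shows "deg A (I - {i}) v = (if v \<in> A i then deg A I v - 1 else deg A I v)"
proof (cases "v \<in> A i")
  case True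
  have "{j \<in> I - {i}. v \<in> A j} = {j \<in> I. v \<in> A j} - {i}" by auto
  with True assms show ?thesis by (simp add: deg_def)
next
  case False
  then have "{j \<in> I - {i}. v \<in> A j} = {j \<in> I. v \<in> A j}" by auto
  with False show ?thesis by (simp add: deg_def)
qed

text \<open>Dropping \<open>A i\<close> lowers \<open>b\<close> by one on \<open>A i\<close> and
  changes nothing else. A smaller \<open>b\<close> cannot create a violation of the kind
  \<open>r = 0\<close>, \<open>b \<ge> 2\<close>, so the new violation sits where \<open>b\<close>
  falls from 1 to 0.\<close>

lemma unremovable_witness:
  assumes "finite I" "i \<in> I" "balanced V A C I J" "\<not> balanced V A C (I - {i}) J"
  shows "\<exists>v\<in>V. v \<in> A i \<and> deg A I v = 1 \<and> deg C J v \<ge> 2"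
proof -
  obtain v where v: "v \<in> V"
    "deg A (I - {i}) v = 0 \<and> deg C J v \<ge> 2 \<or> deg C J v = 0 \<and> deg A (I - {i}) v \<ge> 2"
    using assms(4) by (auto simp: balanced_def not_le)
  have *: "deg A I v = 0 \<longrightarrow> deg C J v \<le> 1" "deg C J v = 0 \<longrightarrow> deg A I v \<le> 1"
    using v(1) assms(3) by (auto simp: balanced_def)
  have "v \<in> A i \<and> deg A I v = 1 \<and> deg C J v \<ge> 2"
    using v(2) * unfolding deg_remove[OF assms(1,2)] by (auto split: if_splits)
  with v(1) show ?thesis by blast
qed

lemma deg_one_unique:
  assumes "deg A I v = 1" "i \<in> I" "j \<in> I" "v \<in> A i" "v \<in> A j"
  shows "i = j"
proof -
  obtain a where "{i \<in> I. v \<in> A i} = {a}"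
    using assms(1) by (auto simp: deg_def card_1_singleton_iff)
  then have "i \<in> {a}" "j \<in> {a}" using assms(2-5) by blast+
  then show ?thesis by simp
qed

text \<open>The witnesses \<open>f i\<close> have \<open>b = 1\<close> and \<open>r \<ge> 2\<close>,
  the witnesses \<open>g j\<close> have \<open>r = 1\<close> and \<open>b \<ge> 2\<close>. Degree
  one makes each map injective, and the differing values of \<open>r\<close> separate the images. If
  \<open>card I + card J = card V\<close>, the images partition \<open>V\<close>.\<close>

lemma unremovable_partition:
  assumes "finite V" "finite I" "finite J" "balanced V A C I J"
    and "\<And>i. i \<in> I \<Longrightarrow> \<not> balanced V A C (I - {i}) J"
    and "\<And>j. j \<in> J \<Longrightarrow> \<not> balanced V A C I (J - {j})"
  obtains f g where
    "\<And>i. i \<in> I \<Longrightarrow> f i \<in> A i \<and> deg A I (f i) = 1" "inj_on f I" "f ` I \<subseteq> V"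
    "\<And>j. j \<in> J \<Longrightarrow> g j \<in> C j \<and> deg C J (g j) = 1" "inj_on g J" "g ` J \<subseteq> V"
    "f ` I \<inter> g ` J = {}" "card I + card J \<le> card V"
proof -
  have "\<forall>i\<in>I. \<exists>v. v \<in> V \<and> v \<in> A i \<and> deg A I v = 1 \<and> deg C J v \<ge> 2"
    using unremovable_witness[OF assms(2) _ assms(4)] assms(5) by blast
  then obtain f where f: "\<forall>i\<in>I. f i \<in> V \<and> f i \<in> A i \<and> deg A I (f i) = 1 \<and> deg C J (f i) \<ge> 2"
    by metis
  have "\<forall>j\<in>J. \<exists>v. v \<in> V \<and> v \<in> C j \<and> deg C J v = 1 \<and> deg A I v \<ge> 2"
    using unremovable_witness[of J _ V C A I] assms(3,4,6) balanced_commute by blast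
  then obtain g where g: "\<forall>j\<in>J. g j \<in> V \<and> g j \<in> C j \<and> deg C J (g j) = 1 \<and> deg A I (g j) \<ge> 2"
    by metis
  have inj: "inj_on f I" "inj_on g J"
    using f g by (metis (no_types, lifting) deg_one_unique inj_onI)+
  have disj: "f ` I \<inter> g ` J = {}"
    using f g by force
  have "card I + card J = card (f ` I \<union> g ` J)"
    using inj disj assms(2,3) by (simp add: card_Un_disjoint card_image)
  also have "\<dots> \<le> card V"
    using f g assms(1) by (intro card_mono) auto
  finally show ?thesis using that f g inj disj by blast
qed

lemma balanced_subfamilies_exist:
  assumes "finite V" "finite I" "finite J" "balanced V A C I J" "card V \<le> card I + card J"
  shows "\<exists>I'\<subseteq>I. \<exists>J'\<subseteq>J. balanced V A C I' J' \<and> card I' + card J' = card V"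
  using assms(2-5)
proof (induction "card I + card J" arbitrary: I J rule: less_induct)
  case less
  show ?case
  proof (cases "card I + card J = card V")
    case True
    with less.prems show ?thesis by blast
  next
    case False
    with less.prems have gt: "card V < card I + card J" by simp
    have "(\<exists>i\<in>I. balanced V A C (I - {i}) J) \<or> (\<exists>j\<in>J. balanced V A C I (J - {j}))"
    proof (rule ccontr)
      assume "\<not> ?thesis"
      then show False
        using unremovable_partition[OF assms(1) less.prems(1-3)] gt by (metis not_le)
    qed
    then show ?thesis
    proof (elim disjE bexE)
      fix i assume i: "i \<in> I" "balanced V A C (I - {i}) J"
      then have "card (I - {i}) + 1 = card I" using less.prems(1)
        by (metis Suc_eq_plus1 card_Suc_Diff1)
      with i(2) gt less.prems have
        "\<exists>I'\<subseteq>I - {i}. \<exists>J'\<subseteq>J. balanced V A C I' J' \<and> card I' + card J' = card V"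
        by (intro less.hyps) auto
      then show ?thesis by (meson Diff_subset subset_trans)
    next
      fix j assume j: "j \<in> J" "balanced V A C I (J - {j})"
      then have "card (J - {j}) + 1 = card J" using less.prems(2)
        by (metis Suc_eq_plus1 card_Suc_Diff1)
      with j(2) gt less.prems have
        "\<exists>I'\<subseteq>I. \<exists>J'\<subseteq>J - {j}. balanced V A C I' J' \<and> card I' + card J' = card V"
        by (intro less.hyps) auto
      then show ?thesis by (meson Diff_subset subset_trans)
    qed
  qed
qed

section \<open>The extremal selection\<close>

text \<open>Here \<open>a\<close> stands for \<open>k - 1\<close>, and the colours enter only
  through intersections of size at most one. For \<open>a = 1\<close> the bound would still permit
  dropping a clique from the extremal selection, hence \<open>a \<ge> 2\<close>.\<close>

lemma cross_families_structure:
  fixes A C :: "'a \<Rightarrow> 'a set"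
  assumes "finite V" "card V = 4 * a" "a \<ge> 2"
    and A: "\<And>v. v \<in> V \<Longrightarrow> A v \<subseteq> V \<and> card (A v) = a + 1 \<and> v \<in> A v"
    and C: "\<And>v. v \<in> V \<Longrightarrow> C v \<subseteq> V \<and> card (C v) = a + 1 \<and> v \<in> C v"
    and AC: "\<And>u v. u \<in> V \<Longrightarrow> v \<in> V \<Longrightarrow> card (A u \<inter> C v) \<le> 1"
  shows "\<exists>X Y p q. X \<inter> Y = {} \<and> X \<union> Y = V \<and> card X = 2 * a \<and> card Y = 2 * a \<and>
     (\<forall>y\<in>Y. p y \<in> V \<and> A (p y) \<inter> Y = {y}) \<and> (\<forall>x\<in>X. q x \<in> V \<and> C (q x) \<inter> X = {x}) \<and>
     (\<forall>y\<in>Y. \<forall>x\<in>X. A (p y) \<inter> C (q x) \<noteq> {})"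
proof -
  have deg_pos: "deg A V v > 0" "deg C V v > 0" if "v \<in> V" for v
    using that A C assms(1) by (auto simp: deg_def card_gt_0_iff)
  then have "balanced V A C V V" by (force simp: balanced_def)
  with balanced_subfamilies_exist[OF assms(1,1,1), of A C] obtain I J where
    IJ: "I \<subseteq> V" "J \<subseteq> V" "balanced V A C I J" "card I + card J = 4 * a"
    using assms(2) by auto
  have fin: "finite I" "finite J" using IJ assms(1) finite_subset by auto
  have cross_le: "(\<Sum>(i,j)\<in>I' \<times> J'. card (A i \<inter> C j)) \<le> card I' * card J'"
    if "I' \<subseteq> V" "J' \<subseteq> V" for I' J'
  proof -
    have "(\<Sum>(i,j)\<in>I' \<times> J'. card (A i \<inter> C j)) \<le> (\<Sum>(i,j)\<in>I' \<times> J'. 1)"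
      using AC that by (intro sum_mono) auto
    then show ?thesis by (simp add: card_cartesian_product)
  qed
  have bound: "(a + 1) * (card I' + card J') \<le> 4 * a + (\<Sum>(i,j)\<in>I' \<times> J'. card (A i \<inter> C j))"
    if "I' \<subseteq> V" "J' \<subseteq> V" "balanced V A C I' J'" for I' J'
    using balanced_bound[of V I' J' A C "a + 1"] that A C assms(1,2) finite_subset by (metis subset_iff)
  have key: "s + t = 4 * a \<Longrightarrow> (a + 1) * (4 * a) \<le> 4 * a + s * t \<Longrightarrow> s = 2 * a \<and> t = 2 * a"
    for s t :: nat
  proof -
    assume st: "s + t = 4 * a" "(a + 1) * (4 * a) \<le> 4 * a + s * t"
    \<comment> \<open>In terms of the deviation \<open>d\<close>, \<open>s t = 4 a^2 - d^2\<close>,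
      so the inequality reduces to \<open>d^2 \<le> 0\<close>.\<close>
    define d where "d = int s - 2 * int a"
    have s: "int s = 2 * int a + d" "int t = 2 * int a - d" using st(1) by (auto simp: d_def)
    have "int ((a + 1) * (4 * a)) \<le> int (4 * a + s * t)" using st(2) by (simp only: of_nat_le_iff)
    then have "d * d \<le> 0" by (simp add: s algebra_simps)
    then have "d = 0" by (metis mult_eq_0_iff not_square_less_zero order_le_less)
    with s show ?thesis by simp
  qed
  have card_IJ: "card I = 2 * a" "card J = 2 * a"
    using key[OF IJ(4)] bound[OF IJ(1-3)] cross_le[OF IJ(1,2)] IJ(4) by auto
  \<comment> \<open>The bound forces the intersection sizes to sum to at least \<open>4 a^2\<close>,
    the number of pairs; as each is at most 1, a single empty intersection would fall short.\<close>
  have meet: "A i \<inter> C j \<noteq> {}" if "i \<in> I" "j \<in> J" for i j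
  proof
    assume e: "A i \<inter> C j = {}"
    have "(\<Sum>(i,j)\<in>I \<times> J. card (A i \<inter> C j)) < (\<Sum>(i,j)\<in>I \<times> J. 1)"
      using AC that IJ(1,2) fin e by (intro sum_strict_mono_ex1) (auto, metis card.empty)
    with bound[OF IJ(1-3)] card_IJ show False
      by (simp add: card_cartesian_product algebra_simps)
  qed
  \<comment> \<open>With one clique fewer the bound reads \<open>5a - 1 \<le> 4a\<close>.\<close>
  have tight: "\<not> balanced V A C I' J'"
    if "I' \<subseteq> V" "J' \<subseteq> V" "card I' + card J' = 4 * a - 1" "card I' * card J' = 2 * a * (2 * a - 1)" for I' J'
  proof
    assume "balanced V A C I' J'"
    then have "(a + 1) * (4 * a - 1) \<le> 4 * a + 2 * a * (2 * a - 1)"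
      using bound[OF that(1,2)] cross_le[OF that(1,2)] that(3,4) by simp
    moreover obtain b where "a = b + 2" using assms(3) by (metis le_add_diff_inverse2)
    ultimately show False by (simp add: algebra_simps)
  qed
  have "\<not> balanced V A C (I - {i}) J" if "i \<in> I" for i
    using that IJ fin card_IJ assms(3) by (intro tight) auto
  moreover have "\<not> balanced V A C I (J - {j})" if "j \<in> J" for j
    using that IJ fin card_IJ assms(3) by (intro tight) auto
  ultimately obtain f g where
    f: "\<And>i. i \<in> I \<Longrightarrow> f i \<in> A i \<and> deg A I (f i) = 1" "inj_on f I" "f ` I \<subseteq> V" and
    g: "\<And>j. j \<in> J \<Longrightarrow> g j \<in> C j \<and> deg C J (g j) = 1" "inj_on g J" "g ` J \<subseteq> V" and
    disj: "f ` I \<inter> g ` J = {}"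
    using unremovable_partition[OF assms(1) fin IJ(3)] by metis
  \<comment> \<open>The witnesses of the blue cliques form \<open>Y\<close>, not \<open>X\<close>:
    in \<open>GXYBR\<close> a blue clique consists of one vertex of \<open>Y\<close> and its blue
    neighbours in \<open>X\<close>.\<close>
  define Y X where "Y = f ` I" and "X = g ` J"
  have cards: "card X = 2 * a" "card Y = 2 * a"
    using f(2) g(2) card_IJ by (simp_all add: X_def Y_def card_image)
  have XY: "X \<inter> Y = {}" using disj by (auto simp: X_def Y_def)
  have "card (X \<union> Y) = card V"
    using cards XY fin assms(2) by (simp add: card_Un_disjoint X_def Y_def)
  then have V: "X \<union> Y = V"
    using f(3) g(3) assms(1) by (intro card_subset_eq) (auto simp: X_def Y_def)
  \<comment> \<open>A witness lies in only one selected blue clique, so \<open>A i\<close> contains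
    no witness of another blue clique and meets \<open>Y\<close> in \<open>f i\<close>
    alone.\<close>
  have p: "inv_into I f y \<in> I \<and> A (inv_into I f y) \<inter> Y = {y}" if "y \<in> Y" for y
  proof -
    from that obtain i where i: "i \<in> I" "y = f i" by (auto simp: Y_def)
    have "i' = i" if "i' \<in> I" "f i' \<in> A i" for i'
      using deg_one_unique[of A I "f i'" i' i] f(1) that i by blast
    then have "A i \<inter> Y = {y}" using f(1) i by (auto simp: Y_def)
    with i f(2) show ?thesis by simp
  qed
  have q: "inv_into J g x \<in> J \<and> C (inv_into J g x) \<inter> X = {x}" if "x \<in> X" for x
  proof -
    from that obtain j where j: "j \<in> J" "x = g j" by (auto simp: X_def)
    have "j' = j" if "j' \<in> J" "g j' \<in> C j" for j'
      using deg_one_unique[of C J "g j'" j' j] g(1) that j by blast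
    then have "C j \<inter> X = {x}" using g(1) j by (auto simp: X_def)
    with j g(2) show ?thesis by simp
  qed
  show ?thesis
    using XY V cards p q meet IJ(1,2)
    by (intro exI[of _ X] exI[of _ Y] exI[of _ "inv_into I f"] exI[of _ "inv_into J g"])
      (simp add: subset_iff)
qed

section \<open>Recovering the coloured graph from its cliques\<close>

lemma mono_clique_Int_le_1:
  assumes "mono_clique G Blue k K" "mono_clique G Red k L"
  shows "card (K \<inter> L) \<le> 1"
proof (rule ccontr)
  assume "\<not> ?thesis"
  then obtain u v where "u \<in> K \<inter> L" "v \<in> K \<inter> L" "u \<noteq> v"
    by (metis One_nat_def card_le_Suc0_iff_eq card.infinite le_SucI le_zero_eq linear)
  with assms show False unfolding mono_clique_def by (metis IntD1 IntD2 color.distinct(1))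
qed

text \<open>The isomorphism is the identity. The edges of \<open>GXYBR X Y B R\<close> are exactly
  those inside the cliques \<open>P y\<close> and \<open>Q x\<close>, and any further edge of
  \<open>G\<close> could be removed without uncovering a vertex.\<close>

lemma isomorphic_GXYBR:
  fixes G :: "'a cgraph"
  assumes k: "k \<ge> 2" and G: "finite_simple_cgraph G" and crit: "edge_critical (clique_covered k) G"
    and XY: "X \<inter> Y = {}" "verts G = X \<union> Y" "card X = 2 * (k - 1)" "card Y = 2 * (k - 1)"
    and P: "\<And>y. y \<in> Y \<Longrightarrow> mono_clique G Blue k (P y) \<and> P y \<inter> Y = {y}"
    and Q: "\<And>x. x \<in> X \<Longrightarrow> mono_clique G Red k (Q x) \<and> Q x \<inter> X = {x}"
    and PQ: "\<And>x y. x \<in> X \<Longrightarrow> y \<in> Y \<Longrightarrow> P y \<inter> Q x \<noteq> {}"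
  shows "\<exists>B R. regular_bipartite (k - 1) X Y B \<and> regular_bipartite (k - 1) X Y R \<and>
           complementary_bipartite X Y B R \<and> cgraph_isomorphic G (GXYBR X Y B R)"
proof -
  have fin: "finite X" "finite Y" using G XY(2) by (auto simp: finite_simple_cgraph_def)
  have Psub: "P y \<subseteq> X \<union> Y" "finite (P y)" "card (P y) = k" if "y \<in> Y" for y
    using P[OF that] XY(2) by (auto simp: mono_clique_def)
  have Qsub: "Q x \<subseteq> X \<union> Y" "finite (Q x)" "card (Q x) = k" if "x \<in> X" for x
    using Q[OF that] XY(2) by (auto simp: mono_clique_def)
  have blue: "{u, v} \<in> edges G \<and> col G {u, v} = Blue" if "y \<in> Y" "u \<in> P y" "v \<in> P y" "u \<noteq> v" for y u v
    using P that by (auto simp: mono_clique_def)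
  have red: "{u, v} \<in> edges G \<and> col G {u, v} = Red" if "x \<in> X" "u \<in> Q x" "v \<in> Q x" "u \<noteq> v" for x u v
    using Q that by (auto simp: mono_clique_def)
  have own: "y \<in> Y \<Longrightarrow> y \<in> P y" "x \<in> X \<Longrightarrow> x \<in> Q x" for x y
    using P Q by blast+
  have only: "y \<in> Y \<Longrightarrow> z \<in> P y \<Longrightarrow> z \<in> Y \<Longrightarrow> z = y"
    "x \<in> X \<Longrightarrow> z \<in> Q x \<Longrightarrow> z \<in> X \<Longrightarrow> z = x" for x y z
    using P Q by (metis IntI singletonD)+
  \<comment> \<open>A common vertex of \<open>P y\<close> and \<open>Q x\<close> can only be
    \<open>x\<close> or \<open>y\<close>, so one of the two memberships holds; both together would
    give \<open>{x, y}\<close> two colours. This is what makes \<open>B\<close> and \<open>R\<close>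
    complementary.\<close>
  have PiffQ: "x \<in> P y \<longleftrightarrow> y \<notin> Q x" if xy: "x \<in> X" "y \<in> Y" for x y
  proof
    assume "x \<in> P y"
    then show "y \<notin> Q x"
      using blue[of y x y] red[of x x y] own that XY(1) by force
  next
    assume "y \<notin> Q x"
    obtain z where z: "z \<in> P y" "z \<in> Q x" using PQ[OF xy] by blast
    have "z \<in> X"
      using z \<open>y \<notin> Q x\<close> only(1)[OF xy(2)] Psub(1)[OF xy(2)] by (metis UnE subsetD)
    then show "x \<in> P y" using z only(2)[OF xy(1)] by metis
  qed
  define B where "B = {{x, y} | x y. x \<in> X \<and> y \<in> Y \<and> x \<in> P y}"
  define R where "R = {{x, y} | x y. x \<in> X \<and> y \<in> Y \<and> y \<in> Q x}"
  have B_iff: "{x, y} \<in> B \<longleftrightarrow> x \<in> P y" and R_iff: "{x, y} \<in> R \<longleftrightarrow> y \<in> Q x" if "x \<in> X" "y \<in> Y" for x y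
    using that XY(1) by (auto simp: B_def R_def doubleton_eq_iff)
  have nbY: "w \<in> X" if "y \<in> Y" "{y, w} \<in> B \<or> {y, w} \<in> R" for y w
    using that XY(1) by (auto simp: B_def R_def doubleton_eq_iff)
  have nbX: "w \<in> Y" if "x \<in> X" "{x, w} \<in> B \<or> {x, w} \<in> R" for x w
    using that XY(1) by (auto simp: B_def R_def doubleton_eq_iff)
  have BR: "complementary_bipartite X Y B R"
    unfolding complementary_bipartite_def
  proof
    show "B \<union> R = complete_bipartite X Y"
      unfolding B_def R_def complete_bipartite_def using PiffQ by blast
    show "B \<inter> R = {}"
      using R_iff PiffQ by (auto simp: B_def)
  qed
  have PX: "card (P y \<inter> X) = k - 1" if "y \<in> Y" for y
  proof -
    have "P y \<inter> X = P y - {y}" using only(1)[OF that] Psub(1)[OF that] that XY(1) by blast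
    then show ?thesis using Psub[OF that] own(1)[OF that] by simp
  qed
  have QY: "card (Q x \<inter> Y) = k - 1" if "x \<in> X" for x
  proof -
    have "Q x \<inter> Y = Q x - {x}" using only(2)[OF that] Qsub(1)[OF that] that XY(1) by blast
    then show ?thesis using Qsub[OF that] own(2)[OF that] by simp
  qed
  have BY: "{w. {y, w} \<in> B} = P y \<inter> X" and RY: "{w. {y, w} \<in> R} = X - (P y \<inter> X)" if "y \<in> Y" for y
  proof -
    have sw: "{y, w} = {w, y}" for w by (simp add: insert_commute)
    show "{w. {y, w} \<in> B} = P y \<inter> X"
      using nbY[OF that] B_iff[OF _ that] unfolding sw by blast
    show "{w. {y, w} \<in> R} = X - (P y \<inter> X)"
      using nbY[OF that] R_iff[OF _ that] PiffQ[OF _ that] unfolding sw by blast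
  qed
  have RX: "{w. {x, w} \<in> R} = Q x \<inter> Y" and BX: "{w. {x, w} \<in> B} = Y - (Q x \<inter> Y)" if "x \<in> X" for x
    using nbX[OF that] B_iff[OF that] R_iff[OF that] PiffQ[OF that] by blast+
  \<comment> \<open>On one side of each graph the degree is the clique size minus one; on the other
    it comes from the complement, as \<open>2 (k - 1) - (k - 1) = k - 1\<close>.\<close>
  have cB: "card {w. {v, w} \<in> B} = k - 1" and cR: "card {w. {v, w} \<in> R} = k - 1" if "v \<in> X \<union> Y" for v
    using that fin XY(3,4) by (auto simp: BX RX BY RY PX QY card_Diff_subset)
  have regB: "regular_bipartite (k - 1) X Y B" and regR: "regular_bipartite (k - 1) X Y R"
    using cB cR BR by (auto simp: regular_bipartite_def complementary_bipartite_def)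
  let ?H = "GXYBR X Y B R"
  \<comment> \<open>A common \<open>B\<close>-neighbour of two vertices of \<open>X\<close> is a
    \<open>y\<close> whose clique \<open>P y\<close> contains both.\<close>
  have "(\<exists>w. {u, w} \<in> B \<and> {v, w} \<in> B) \<longleftrightarrow> (\<exists>y\<in>Y. u \<in> P y \<and> v \<in> P y)" if "u \<in> X" "v \<in> X" for u v
    using nbX[OF that(1)] B_iff[OF that(1)] B_iff[OF that(2)] by blast
  then have cnX: "common_neighbor_pairs X B
      = {{u, v} | u v. u \<in> X \<and> v \<in> X \<and> u \<noteq> v \<and> (\<exists>y\<in>Y. u \<in> P y \<and> v \<in> P y)}"
    unfolding common_neighbor_pairs_def
    by (intro Collect_cong ex_cong1) (simp cong: conj_cong)
  have "(\<exists>w. {u, w} \<in> R \<and> {v, w} \<in> R) \<longleftrightarrow> (\<exists>x\<in>X. u \<in> Q x \<and> v \<in> Q x)" if "u \<in> Y" "v \<in> Y" for u v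
    using RY[OF that(1)] RY[OF that(2)] PiffQ[OF _ that(1)] PiffQ[OF _ that(2)] by blast
  then have cnY: "common_neighbor_pairs Y R
      = {{u, v} | u v. u \<in> Y \<and> v \<in> Y \<and> u \<noteq> v \<and> (\<exists>x\<in>X. u \<in> Q x \<and> v \<in> Q x)}"
    unfolding common_neighbor_pairs_def
    by (intro Collect_cong ex_cong1) (simp cong: conj_cong)
  have bip: "{x, y} \<in> edges ?H" "{y, x} \<in> edges ?H" if "x \<in> X" "y \<in> Y" for x y
  proof -
    show "{x, y} \<in> edges ?H" using that by (auto simp: GXYBR_def complete_bipartite_def)
    then show "{y, x} \<in> edges ?H" by (simp add: insert_commute)
  qed
  \<comment> \<open>The only vertex of \<open>P y\<close> outside \<open>X\<close> is
    \<open>y\<close>, so a pair not within \<open>X\<close> is a bipartite edge.\<close>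
  have PH: "{u, v} \<in> edges ?H" if "y \<in> Y" "u \<in> P y" "v \<in> P y" "u \<noteq> v" for y u v
  proof (cases "u \<in> X \<and> v \<in> X")
    case True
    then have "{u, v} \<in> common_neighbor_pairs X B" unfolding cnX using that by blast
    then show ?thesis by (simp add: GXYBR_def)
  next
    case False
    then show ?thesis
      using that only(1)[OF that(1)] Psub(1)[OF that(1)] bip by (metis UnE subsetD)
  qed
  have QH: "{u, v} \<in> edges ?H" if "x \<in> X" "u \<in> Q x" "v \<in> Q x" "u \<noteq> v" for x u v
  proof (cases "u \<in> Y \<and> v \<in> Y")
    case True
    then have "{u, v} \<in> common_neighbor_pairs Y R" unfolding cnY using that by blast
    then show ?thesis by (simp add: GXYBR_def)
  next
    case False
    then show ?thesis
      using that only(2)[OF that(1)] Qsub(1)[OF that(1)] bip by (metis UnE subsetD)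
  qed
  have HG: "e \<in> edges G \<and> col G e = col ?H e" if e: "e \<in> edges ?H" for e
  proof (cases "e \<in> R \<union> common_neighbor_pairs Y R")
    case True
    then have "e \<in> edges G \<and> col G e = Red"
    proof
      assume "e \<in> R"
      then obtain x y where "e = {x, y}" "x \<in> X" "y \<in> Y" "y \<in> Q x" by (auto simp: R_def)
      then show ?thesis using red[of x x y] own(2)[of x] XY(1) by blast
    next
      assume "e \<in> common_neighbor_pairs Y R"
      then show ?thesis unfolding cnY using red by auto
    qed
    then show ?thesis using GXYBR_red[OF XY(1) BR e] True by simp
  next
    case False
    then have "e \<in> B \<union> common_neighbor_pairs X B"
      using e BR by (auto simp: GXYBR_def complementary_bipartite_def)
    then have "e \<in> edges G \<and> col G e = Blue"
    proof
      assume "e \<in> B"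
      then obtain x y where "e = {x, y}" "x \<in> X" "y \<in> Y" "x \<in> P y" by (auto simp: B_def)
      then show ?thesis using blue[of y x y] own(1)[of y] XY(1) by blast
    next
      assume "e \<in> common_neighbor_pairs X B"
      then show ?thesis unfolding cnX using blue by auto
    qed
    then show ?thesis using GXYBR_red[OF XY(1) BR e] False by (metis color.exhaust)
  qed
  have "edges G \<subseteq> edges ?H"
  proof (rule ccontr)
    assume "\<not> ?thesis"
    then obtain e where e: "e \<in> edges G" "e \<notin> edges ?H" by blast
    have P': "mono_clique (remove_edge G e) Blue k (P y)" if "y \<in> Y" for y
      using P[OF that] PH[OF that] e(2) unfolding mono_clique_def remove_edge_def by auto
    have Q': "mono_clique (remove_edge G e) Red k (Q x)" if "x \<in> X" for x
      using Q[OF that] QH[OF that] e(2) unfolding mono_clique_def remove_edge_def by auto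
    \<comment> \<open>A vertex of \<open>Y\<close> lies in its own blue clique; a vertex of
      \<open>X\<close> has a \<open>B\<close>-neighbour \<open>y\<close>, because
      \<open>k - 1 > 0\<close>, and so lies in \<open>P y\<close>.\<close>
    have "\<exists>y\<in>Y. v \<in> P y" if "v \<in> X \<union> Y" for v
    proof (cases "v \<in> Y")
      case False
      with that have "v \<in> X" by blast
      have "card {w. {v, w} \<in> B} \<noteq> 0" using cB[OF that] k by simp
      then have "{w. {v, w} \<in> B} \<noteq> {}" by (rule contrapos_nn) (simp only: card.empty)
      then obtain w where "{v, w} \<in> B" by blast
      then show ?thesis using nbX[OF \<open>v \<in> X\<close>] B_iff[OF \<open>v \<in> X\<close>] by metis
    qed (use own in blast)
    moreover have "\<exists>x\<in>X. v \<in> Q x" if "v \<in> X \<union> Y" for v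
    proof (cases "v \<in> X")
      case False
      with that have "v \<in> Y" by blast
      have "card {w. {v, w} \<in> R} \<noteq> 0" using cR[OF that] k by simp
      then have "{w. {v, w} \<in> R} \<noteq> {}" by (rule contrapos_nn) (simp only: card.empty)
      then obtain w where "{v, w} \<in> R" by blast
      then show ?thesis
        using nbY[OF \<open>v \<in> Y\<close>] R_iff[OF _ \<open>v \<in> Y\<close>] by (metis insert_commute)
    qed (use own in blast)
    ultimately have "\<exists>K. mono_clique (remove_edge G e) c k K \<and> v \<in> K" if "v \<in> X \<union> Y" for v c
      using P' Q' that by (cases c) blast+
    then have "clique_covered k (remove_edge G e)"
      using XY(2) by (simp add: clique_covered_def remove_edge_def)
    with crit e(1) show False by (simp add: edge_critical_def)
  qed
  with HG have "edges G = edges ?H" "\<forall>e\<in>edges G. col G e = col ?H e" by auto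
  then have "cgraph_isomorphic G ?H"
    using XY(2) unfolding cgraph_isomorphic_def
    by (intro exI[of _ id]) (simp add: GXYBR_def)
  with regB regR BR show ?thesis by blast
qed

section \<open>The case \<open>k = 2\<close>\<close>

lemma mono_clique_2:
  assumes "mono_clique G c 2 K" "v \<in> K"
  shows "\<exists>w. w \<in> verts G \<and> w \<noteq> v \<and> {v, w} \<in> edges G \<and> col G {v, w} = c"
proof -
  from assms(1) obtain x y where "K = {x, y}" "x \<noteq> y"
    by (auto simp: mono_clique_def card_2_iff)
  with assms show ?thesis by (auto simp: mono_clique_def)
qed

text \<open>Every vertex has a blue and a red neighbour. Starting from a blue neighbour
  \<open>p\<close> and a red neighbour \<open>q\<close> of \<open>v\<close>, only one further vertex
  \<open>w\<close> remains, and finitely many colourings are left to check.\<close>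

lemma alternating_four_cycle:
  assumes G: "card (verts G) = 4" "clique_covered 2 G"
  shows "\<exists>v p w q. verts G = {v, p, w, q} \<and> distinct [v, p, w, q] \<and>
    mono_clique G Blue 2 {v, p} \<and> mono_clique G Red 2 {p, w} \<and>
    mono_clique G Blue 2 {w, q} \<and> mono_clique G Red 2 {q, v}"
proof -
  define E where "E c u w \<longleftrightarrow> {u, w} \<in> edges G \<and> col G {u, w} = c" for c u w
  have sym: "E c u w \<Longrightarrow> E c w u" for c u w by (simp add: E_def insert_commute)
  have excl: "E Blue u w \<Longrightarrow> \<not> E Red u w" for u w by (auto simp: E_def)
  have ex: "\<exists>w. w \<in> verts G \<and> w \<noteq> v \<and> E c v w" if "v \<in> verts G" for v c
    using G(2) that mono_clique_2 unfolding clique_covered_def E_def by metis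
  have "verts G \<noteq> {}" using G(1) by auto
  then obtain v where v: "v \<in> verts G" by blast
  obtain p where p: "p \<in> verts G" "p \<noteq> v" "E Blue v p" using ex[OF v] by blast
  obtain q where q: "q \<in> verts G" "q \<noteq> v" "E Red v q" using ex[OF v] by blast
  have "p \<noteq> q" using p q excl by blast
  have "card (verts G - {v, p, q}) = 1"
    using G(1) v p q \<open>p \<noteq> q\<close> by (subst card_Diff_subset) auto
  then obtain w where w: "verts G - {v, p, q} = {w}" by (auto simp: card_1_singleton_iff)
  then have V: "verts G = {v, p, w, q}" "w \<noteq> v" "w \<noteq> p" "w \<noteq> q" using v p q by auto
  have cl: "mono_clique G c 2 {x, y}" if "x \<in> verts G" "y \<in> verts G" "x \<noteq> y" "E c x y" for c x y
    using that sym[OF that(4)] by (auto simp: mono_clique_def E_def)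
  have nb: "E c x v \<and> x \<noteq> v \<or> E c x p \<and> x \<noteq> p \<or> E c x w \<and> x \<noteq> w \<or> E c x q \<and> x \<noteq> q"
    if "x \<in> verts G" for c x
    using ex[OF that, of c] V(1) by auto
  have flip: "E c p v = E c v p" "E c q v = E c v q" "E c w v = E c v w"
    "E c q p = E c p q" "E c w p = E c p w" "E c w q = E c q w" for c
    using sym by blast+
  \<comment> \<open>The disjuncts correspond to the three 4-cycles on four vertices, each with the
    alternating colouring that agrees with blue \<open>{v, p}\<close> and red
    \<open>{v, q}\<close>.\<close>
  have "E Blue w q \<and> E Red p w \<or> E Blue v w \<and> E Red w p \<and> E Blue p q
     \<or> E Blue p v \<and> E Red v w \<and> E Blue w q \<and> E Red q p"
    using nb[OF p(1), of Red] nb[OF q(1), of Blue] nb[of w Red] nb[of w Blue] V(1) p(3) q(3)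
      excl[of v p] excl[of v q] excl[of v w] excl[of p q] excl[of p w] excl[of q w]
    unfolding flip by auto
  then show ?thesis
  proof (elim disjE conjE)
    assume "E Blue w q" "E Red p w"
    then show ?thesis using V p q \<open>p \<noteq> q\<close> sym
      by (intro exI[of _ v] exI[of _ p] exI[of _ w] exI[of _ q]) (auto intro!: cl)
  next
    assume "E Blue v w" "E Red w p" "E Blue p q"
    then show ?thesis using V p q \<open>p \<noteq> q\<close> sym
      by (intro exI[of _ v] exI[of _ w] exI[of _ p] exI[of _ q]) (auto intro!: cl)
  next
    assume "E Blue p v" "E Red v w" "E Blue w q" "E Red q p"
    then show ?thesis using V p q \<open>p \<noteq> q\<close> sym
      by (intro exI[of _ p] exI[of _ v] exI[of _ w] exI[of _ q]) (auto intro!: cl)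
  qed
qed

theorem theorem3:
  fixes k :: nat and G :: "'a cgraph"
  assumes "k \<ge> 2"
    and "finite_simple_cgraph G"
    and "card (verts G) = 4 * (k - 1)"
    and "edge_critical (clique_covered k) G"
  shows "\<exists>(X :: 'a set) Y B R.
           X \<inter> Y = {} \<and> card X = 2 * (k - 1) \<and> card Y = 2 * (k - 1) \<and>
           regular_bipartite (k - 1) X Y B \<and> regular_bipartite (k - 1) X Y R \<and>
           complementary_bipartite X Y B R \<and>
           cgraph_isomorphic G (GXYBR X Y B R)"
proof -
  have cov: "clique_covered k G" using assms(4) by (simp add: edge_critical_def)
  \<comment> \<open>Both cases end in the same data: blue cliques indexed by their single vertex in
    \<open>Y\<close>, red ones by their single vertex in \<open>X\<close>, all crossing.\<close>
  have "\<exists>X Y P Q. X \<inter> Y = {} \<and> verts G = X \<union> Y \<and> card X = 2 * (k - 1) \<and> card Y = 2 * (k - 1) \<and>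
      (\<forall>y\<in>Y. mono_clique G Blue k (P y) \<and> P y \<inter> Y = {y}) \<and>
      (\<forall>x\<in>X. mono_clique G Red k (Q x) \<and> Q x \<inter> X = {x}) \<and>
      (\<forall>x\<in>X. \<forall>y\<in>Y. P y \<inter> Q x \<noteq> {})"
  proof (cases "k = 2")
    case True
    then obtain v p w q where c: "verts G = {v, p, w, q}" "distinct [v, p, w, q]"
      "mono_clique G Blue 2 {v, p}" "mono_clique G Red 2 {p, w}"
      "mono_clique G Blue 2 {w, q}" "mono_clique G Red 2 {q, v}"
      using alternating_four_cycle[of G] assms(3) cov by auto
    with True show ?thesis
      \<comment> \<open>\<open>X\<close> and \<open>Y\<close> are the pairs of opposite vertices of
        the cycle; a blue edge is indexed by its end in \<open>Y\<close>, a red edge by its end in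
        \<open>X\<close>.\<close>
      by (intro exI[of _ "{v, w}"] exI[of _ "{p, q}"]
          exI[of _ "\<lambda>y. if y = p then {v, p} else {w, q}"]
          exI[of _ "\<lambda>x. if x = v then {q, v} else {p, w}"]) auto
  next
    case False
    obtain A where A: "\<And>v. v \<in> verts G \<Longrightarrow> mono_clique G Blue k (A v) \<and> v \<in> A v"
      using cov unfolding clique_covered_def by meson
    obtain C where C: "\<And>v. v \<in> verts G \<Longrightarrow> mono_clique G Red k (C v) \<and> v \<in> C v"
      using cov unfolding clique_covered_def by meson
    have "\<exists>X Y p q. X \<inter> Y = {} \<and> X \<union> Y = verts G \<and> card X = 2 * (k - 1) \<and> card Y = 2 * (k - 1) \<and>
       (\<forall>y\<in>Y. p y \<in> verts G \<and> A (p y) \<inter> Y = {y}) \<and> (\<forall>x\<in>X. q x \<in> verts G \<and> C (q x) \<inter> X = {x}) \<and>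
       (\<forall>y\<in>Y. \<forall>x\<in>X. A (p y) \<inter> C (q x) \<noteq> {})"
    proof (rule cross_families_structure)
      show "finite (verts G)" using assms(2) by (simp add: finite_simple_cgraph_def)
      show "card (A u \<inter> C v) \<le> 1" if "u \<in> verts G" "v \<in> verts G" for u v
        using A C that mono_clique_Int_le_1 by blast
    qed (use assms(1,3) False A C in \<open>auto simp: mono_clique_def\<close>)
    then obtain X Y p q where "X \<inter> Y = {}" "X \<union> Y = verts G" "card X = 2 * (k - 1)" "card Y = 2 * (k - 1)"
       "\<forall>y\<in>Y. p y \<in> verts G \<and> A (p y) \<inter> Y = {y}" "\<forall>x\<in>X. q x \<in> verts G \<and> C (q x) \<inter> X = {x}"
       "\<forall>y\<in>Y. \<forall>x\<in>X. A (p y) \<inter> C (q x) \<noteq> {}"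
      by blast
    with A C show ?thesis
      by (intro exI[of _ X] exI[of _ Y] exI[of _ "\<lambda>y. A (p y)"] exI[of _ "\<lambda>x. C (q x)"]) auto
  qed
  then obtain X Y P Q where *: "X \<inter> Y = {}" "verts G = X \<union> Y" "card X = 2 * (k - 1)" "card Y = 2 * (k - 1)"
    "\<forall>y\<in>Y. mono_clique G Blue k (P y) \<and> P y \<inter> Y = {y}"
    "\<forall>x\<in>X. mono_clique G Red k (Q x) \<and> Q x \<inter> X = {x}"
    "\<forall>x\<in>X. \<forall>y\<in>Y. P y \<inter> Q x \<noteq> {}"
    by blast
  have "\<exists>B R. regular_bipartite (k - 1) X Y B \<and> regular_bipartite (k - 1) X Y R \<and>
           complementary_bipartite X Y B R \<and> cgraph_isomorphic G (GXYBR X Y B R)"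
    by (rule isomorphic_GXYBR[OF assms(1,2,4) *(1-4), of P Q]) (use *(5-7) in auto)
  then show ?thesis using *(1,3,4) by blast
qed

end
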